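(* Let $ABC$ be a non-degenerate triangle in the Euclidean plane. Let $A_1$ be the point of side $BC$ such that $AA_1$ bisects the interior angle $\angle CAB$, and let $B_1$ be the point of side $AC$ such that $BB_1$ bisects the interior angle $\angle CBA$. If $|AA_1| = |BB_1|$, then triangle $ABC$ is isosceles with base $AB$, i.e. $|CA| = |CB|$.
   Context: $|XY|$ denotes the length of the segment $XY$. The base of the triangle is the side $AB$. *)

theory Defs
  imports "HOL-Analysis.Analysis"
begin

text \<open>
  The unoriented angle at \<open>Y\<close>, in \<open>[0, pi]\<close>, between the rays \<open>YX\<close> and \<open>YZ\<close>.
  For \<open>X = Y\<close> or \<open>Z = Y\<close> there is no angle, and the formula gives the
  junk value \<open>arccos 0 = pi / 2\<close>.
\<close>

definition angle :: "real^2 \<Rightarrow> real^2 \<Rightarrow> real^2 \<Rightarrow> real" where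
  "angle X Y Z = arccos (((X - Y) \<bullet> (Z - Y)) / (norm (X - Y) * norm (Z - Y)))"

end

theory Submission
  imports Defs
begin

text \<open>
  With side lengths \<open>a\<close>, \<open>b\<close>, \<open>c\<close>, the squared length of the bisector from \<open>A\<close> is
  \<open>b c (1 - (a / (b + c))\<^sup>2)\<close>, and that of the bisector from \<open>B\<close> is
  \<open>a c (1 - (b / (a + c))\<^sup>2)\<close>. If \<open>a < b\<close>, both factors of the first expression
  are larger than those of the second, so the bisectors differ in length.
\<close>

text \<open>Cauchy-Schwarz puts the quotient in [-1, 1], where \<open>cos\<close> undoes
  \<open>arccos\<close>; in the degenerate case division by zero makes it 0.\<close>

lemma cos_angle:
  "cos (angle X Y Z) = ((X - Y) \<bullet> (Z - Y)) / (norm (X - Y) * norm (Z - Y))"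
proof -
  have "\<bar>((X - Y) \<bullet> (Z - Y)) / (norm (X - Y) * norm (Z - Y))\<bar> \<le> 1"
    using Cauchy_Schwarz_ineq2[of "X - Y" "Z - Y"] by (auto simp: divide_le_eq_1 zero_less_mult_iff)
  then show ?thesis
    by (simp add: angle_def cos_arccos_abs)
qed

text \<open>The angle bisector theorem in vector form, with the apex at 0. Cleared of denominators,
  the equality of cosines has the factor \<open>u \<bullet> v - norm u * norm v\<close>, which is
  nonzero because equality in Cauchy-Schwarz forces collinearity.\<close>

lemma bisector_ratio:
  fixes u v :: "'a::real_inner"
  assumes uv: "\<not> collinear {0, u, v}"
    and w: "w = (1 - t) *\<^sub>R u + t *\<^sub>R v"
    and eq: "(v \<bullet> w) / (norm v * norm w) = (w \<bullet> u) / (norm w * norm u)"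
  shows "(1 - t) * norm u = t * norm v"
proof -
  have u: "norm u > 0" and v: "norm v > 0"
    using uv by (auto simp: collinear_lemma)
  have lt: "u \<bullet> v \<noteq> norm u * norm v"
    using uv norm_cauchy_schwarz_equal[of u v] by auto
  \<comment> \<open>For \<open>w = 0\<close> both quotients in \<open>eq\<close> would be 0 and
    \<open>eq\<close> would carry no information.\<close>
  have "w \<noteq> 0"
  proof
    assume "w = 0"
    then have v_eq: "t *\<^sub>R v = (t - 1) *\<^sub>R u"
      using w by (simp add: algebra_simps add_eq_0_iff)
    have "t \<noteq> 0"
      using v_eq u by auto
    then have "v = ((t - 1) / t) *\<^sub>R u"
      using arg_cong[OF v_eq, of "\<lambda>x. (1 / t) *\<^sub>R x"] by simp
    then show False
      using uv by (auto simp: collinear_lemma)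
  qed
  then have "(v \<bullet> w) * norm u = (w \<bullet> u) * norm v"
    using eq u v by (simp add: field_simps)
  then have "((1 - t) * (u \<bullet> v) + t * (norm v)\<^sup>2) * norm u
      = ((1 - t) * (norm u)\<^sup>2 + t * (u \<bullet> v)) * norm v"
    by (simp add: w inner_add inner_commute power2_norm_eq_inner)
  then have "(u \<bullet> v - norm u * norm v) * ((1 - t) * norm u - t * norm v) = 0"
    by algebra
  then show ?thesis
    using lt by simp
qed

text \<open>With \<open>A\<close> moved to the origin, the angle bisector theorem fixes the position
  of \<open>D\<close> on the side, and the law of cosines eliminates the inner product of the two
  side vectors.\<close>

lemma bisector_length:
  assumes ABC: "\<not> collinear {A, B, C}"
    and D: "D \<in> closed_segment B C" and bisects: "angle C A D = angle D A B"
  shows "(dist A D)\<^sup>2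
    = dist A C * dist A B * (1 - (dist B C / (dist A C + dist A B))\<^sup>2)"
proof -
  define u v where "u = B - A" and "v = C - A"
  have uv: "\<not> collinear {0, u, v}"
    using ABC collinear_3[of B A C] by (simp add: u_def v_def insert_commute)
  then have pos: "norm u > 0" "norm v > 0"
    by (auto simp: collinear_lemma)
  obtain t where t: "D = (1 - t) *\<^sub>R B + t *\<^sub>R C"
    using D by (auto simp: in_segment)
  define w where "w = D - A"
  have w: "w = (1 - t) *\<^sub>R u + t *\<^sub>R v"
    by (simp add: w_def t u_def v_def algebra_simps)
  have "(v \<bullet> w) / (norm v * norm w) = (w \<bullet> u) / (norm w * norm u)"
    using arg_cong[OF bisects, of cos] by (simp add: cos_angle u_def v_def w_def)
  then have ratio: "(1 - t) * norm u = t * norm v"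
    using bisector_ratio[OF uv w] by blast
  have "w \<bullet> w = (1 - t)\<^sup>2 * (norm u)\<^sup>2 + 2 * (1 - t) * t * (u \<bullet> v) + t\<^sup>2 * (norm v)\<^sup>2"
    unfolding power2_norm_eq_inner
    by (simp add: w inner_add inner_commute power2_eq_square algebra_simps)
  moreover have "(norm (v - u))\<^sup>2 = (norm v)\<^sup>2 - 2 * (u \<bullet> v) + (norm u)\<^sup>2"
    by (simp add: power2_norm_eq_inner inner_diff inner_commute)
  moreover have t_eq: "t * (norm v + norm u) = norm u"
    using ratio by (simp add: algebra_simps)
  \<comment> \<open>With m = \<open>norm u\<close>, n = \<open>norm v\<close>, the weights t and 1 -
    t times m + n are m and n, so both sides equal 2mn(mn + \<open>u \<bullet> v\<close>).\<close>
  ultimately have "(norm w)\<^sup>2 * (norm v + norm u)\<^sup>2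
      = norm v * norm u * ((norm v + norm u)\<^sup>2 - (norm (v - u))\<^sup>2)"
    unfolding power2_norm_eq_inner[of w] by algebra
  moreover have "norm v + norm u \<noteq> 0"
    using pos by linarith
  ultimately have "(norm w)\<^sup>2 = norm v * norm u * (1 - (norm (v - u) / (norm v + norm u))\<^sup>2)"
    by (simp add: field_simps)
  then show ?thesis
    by (simp add: u_def v_def w_def dist_norm norm_minus_commute)
qed

lemma bisector_length_strict_mono:
  fixes a b c :: real
  assumes "0 < a" "a < b" "0 < c" "b < a + c"
  shows "a * c * (1 - (b / (a + c))\<^sup>2) < b * c * (1 - (a / (b + c))\<^sup>2)"
proof (rule mult_strict_mono)
  show "a * c < b * c"
    using assms by simp
  have "a / (b + c) < b / (a + c)"
    using assms by (intro frac_less) auto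
  then show "1 - (b / (a + c))\<^sup>2 < 1 - (a / (b + c))\<^sup>2"
    using assms by (simp add: power_strict_mono)
  show "0 < b * c"
    using assms by simp
  \<comment> \<open>The triangle inequality \<open>b < a + c\<close> keeps this factor nonnegative,
    so that the two strict inequalities can be multiplied.\<close>
  show "0 \<le> 1 - (b / (a + c))\<^sup>2"
    using assms by (simp add: power_le_one)
qed

text \<open>Equality would put \<open>B\<close> between \<open>A\<close> and \<open>C\<close>,
  making the three points collinear.\<close>

lemma triangle_strict:
  fixes A B C :: "'a::euclidean_space"
  assumes "\<not> collinear {A, B, C}"
  shows "dist A C < dist A B + dist B C"
proof -
  have "\<not> between (A, C) B"
    using assms between_imp_collinear[of A C B] by (auto simp: insert_commute)
  then show ?thesis
    using dist_triangle[of A C B] by (auto simp: between dist_commute)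
qed

theorem theorem3p1:
  fixes A B C A\<^sub>1 B\<^sub>1 :: "real^2"
  assumes "\<not> collinear {A, B, C}"
    and "A\<^sub>1 \<in> closed_segment B C" and "angle C A A\<^sub>1 = angle A\<^sub>1 A B"
    and "B\<^sub>1 \<in> closed_segment A C" and "angle C B B\<^sub>1 = angle B\<^sub>1 B A"
    and "dist A A\<^sub>1 = dist B B\<^sub>1"
  shows "dist C A = dist C B"
proof -
  define a b c where "a = dist B C" and "b = dist A C" and "c = dist A B"
  have BAC: "\<not> collinear {B, A, C}"
    using assms(1) by (simp add: insert_commute)
  have pos: "0 < a" "0 < b" "0 < c"
    using assms(1) by (auto simp: a_def b_def c_def insert_commute)
  have tri: "b < a + c" "a < b + c"
    using triangle_strict[OF assms(1)] triangle_strict[OF BAC]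
    by (simp_all add: a_def b_def c_def dist_commute)
  have "(dist A A\<^sub>1)\<^sup>2 = b * c * (1 - (a / (b + c))\<^sup>2)"
    using bisector_length[OF assms(1-3)] by (simp add: a_def b_def c_def)
  moreover have "(dist B B\<^sub>1)\<^sup>2 = a * c * (1 - (b / (a + c))\<^sup>2)"
    using bisector_length[OF BAC assms(4,5)]
    by (simp add: a_def b_def c_def dist_commute[of B A])
  ultimately have "b * c * (1 - (a / (b + c))\<^sup>2) = a * c * (1 - (b / (a + c))\<^sup>2)"
    using assms(6) by metis
  \<comment> \<open>Strict monotonicity excludes \<open>a < b\<close> directly and
    \<open>b < a\<close> with the roles of \<open>a\<close> and \<open>b\<close> exchanged.\<close>
  then have "a = b"
    using bisector_length_strict_mono[of a b c] bisector_length_strict_mono[of b a c] pos tri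
    by (cases a b rule: linorder_cases) auto
  then show ?thesis
    by (simp add: a_def b_def dist_commute)
qed

end
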